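(* Let $N,T\ge 1$ and let $N$ qubits be placed at positions $1,\dots,N$ of a stack, position $1$ being the top. Let $q_1,\dots,q_T$ be any sequence of these qubits: at step $s\in\{1,\dots,T\}$ the qubit $q_s$ is required to be at position $1$. Assume that before step $1$ the qubits are ordered according to their first use (so the initial labels satisfy $m_1=1$ and $m_i<m_{i+1}$ for all $1\le i<N$). Then the two-round swap procedure described in the context, carried out after every step, guarantees that at every step $s\in\{1,\dots,T\}$ one has $m_1\le m_i$ for all positions $i$ and $m_1=s$, i.e. the required qubit $q_s$ is at position $1$ at step $s$. In particular, two rounds of parallel nearest-neighbor swaps between consecutive steps always suffice to bring the next required qubit to the top of the stack.
   Context: Labels. At step $s$, each position $i$ carries an integer label $m_i\ge s$, attached to the qubit currently at position $i$ and moving with it: $m_i$ is the first step $t\ge s$ such that $q_t$ is that qubit, if such a $t$ exists; for a qubit that will not be used again the label is an arbitrary integer larger than $T$. All labels at any given time are pairwise distinct ($m_i\ne m_j$ for $i\neq j$). Procedure. After step $s$ is performed, the label $m_1$ is updated to its new value (the next step $t>s$ at which the qubit at position $1$ is required or, if there is none, an integer larger than $T$ different from all other labels); all other labels stay the same. Then two rounds of parallel swaps are performed: Round 1: for every $n\ge 0$ with $2n+2\le N$, if $m_{2n+1}>m_{2n+2}$, swap the qubits at positions $2n+1$ and $2n+2$ (and their labels accordingly). Round 2: for every $n\ge 1$ with $2n+1\le N$, if $m_{2n}>m_{2n+1}$, swap the qubits at positions $2n$ and $2n+1$ (and their labels accordingly). The resulting configuration is the one at step $s+1$. *)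

theory Defs
  imports Main
begin

text \<open>
  A stack maps each position \<open>1, \<dots>, N\<close> to the qubit there together with its label;
  the values outside \<open>{1..N}\<close> are irrelevant and never touched.
  Labels are at least the current step, hence positive, so they are natural numbers.
\<close>

type_synonym 'q stack = "nat \<Rightarrow> 'q \<times> nat"

abbreviation qubit_at :: "'q stack \<Rightarrow> nat \<Rightarrow> 'q" where
  "qubit_at c i \<equiv> fst (c i)"

abbreviation label_at :: "'q stack \<Rightarrow> nat \<Rightarrow> nat" where
  "label_at c i \<equiv> snd (c i)"

text \<open>A relation, since the label of a qubit that is not used again is an arbitrary number above \<open>T\<close>.\<close>

definition is_label :: "nat \<Rightarrow> (nat \<Rightarrow> 'q) \<Rightarrow> nat \<Rightarrow> 'q \<Rightarrow> nat \<Rightarrow> bool" where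
  "is_label T q s x k \<longleftrightarrow>
     (if \<exists>t\<in>{s..T}. q t = x then k = (LEAST t. t \<in> {s..T} \<and> q t = x) else k > T)"

text \<open>
  \<open>L\<close> is the set of left positions \<open>i\<close> of the pairs \<open>(i, i + 1)\<close> compared in the round.
  It must not contain two consecutive positions, so that the pairs are disjoint.
\<close>

definition swap_round :: "nat set \<Rightarrow> 'q stack \<Rightarrow> 'q stack" where
  "swap_round L c = (\<lambda>i.
     if i \<in> L \<and> label_at c i > label_at c (i + 1) then c (i + 1)
     else if i \<ge> 1 \<and> i - 1 \<in> L \<and> label_at c (i - 1) > label_at c i then c (i - 1)
     else c i)"

definition round1 :: "nat \<Rightarrow> 'q stack \<Rightarrow> 'q stack" where
  "round1 N = swap_round {2 * n + 1 | n. 2 * n + 2 \<le> N}"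

definition round2 :: "nat \<Rightarrow> 'q stack \<Rightarrow> 'q stack" where
  "round2 N = swap_round {2 * n | n. n \<ge> 1 \<and> 2 * n + 1 \<le> N}"

text \<open>
  The transition from step \<open>s\<close> to step \<open>s + 1\<close>. The relabelled qubit is the one at position 1,
  which is not presupposed to be \<open>q s\<close>.
\<close>

definition next_stack ::
    "nat \<Rightarrow> nat \<Rightarrow> (nat \<Rightarrow> 'q) \<Rightarrow> nat \<Rightarrow> 'q stack \<Rightarrow> 'q stack \<Rightarrow> bool" where
  "next_stack N T q s c c' \<longleftrightarrow>
     (\<exists>k. is_label T q (s + 1) (qubit_at c 1) k \<and>
          (k > T \<longrightarrow> (\<forall>i\<in>{2..N}. k \<noteq> label_at c i)) \<and>
          c' = round2 N (round1 N (c(1 := (qubit_at c 1, k)))))"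

end

(*
  Call the rank of position i the number of positions above i whose label is at most m_i.
  The invariant is that every position i >= 2 has rank at least i/2; it holds for an ordered
  stack, and it implies that the top label is minimal. Relabelling the top lowers each rank by
  at most 1, so that 2 * rank >= i - 2. By the parity of i, each of the two rounds improves this
  bound by 1, and the invariant is restored.
*)
theory Submission
  imports Defs
begin

text \<open>The threshold \<open>v\<close> is kept apart from \<open>m i\<close>: a swap may change
  the label at \<open>i\<close> while the count above \<open>i\<close> for a fixed threshold stays
  the same.\<close>

definition count_above :: "(nat \<Rightarrow> nat) \<Rightarrow> nat \<Rightarrow> nat \<Rightarrow> nat" where
  "count_above m i v = card {l \<in> {1..<i}. m l \<le> v}"

abbreviation rank :: "(nat \<Rightarrow> nat) \<Rightarrow> nat \<Rightarrow> nat" where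
  "rank m i \<equiv> count_above m i (m i)"

text \<open>A source map: the entry at \<open>i\<close> after the round comes from
  \<open>swap_index L m i\<close>. A round is thus a composition, and one map moves qubits and
  labels together.\<close>

definition swap_index :: "nat set \<Rightarrow> (nat \<Rightarrow> nat) \<Rightarrow> nat \<Rightarrow> nat" where
  "swap_index L m i =
     (if i \<in> L \<and> m i > m (i + 1) then i + 1
      else if i \<ge> 1 \<and> i - 1 \<in> L \<and> m (i - 1) > m i then i - 1
      else i)"

text \<open>The parity \<open>d\<close> is 1 in the first round and 0 in the second. The same number
  is the slack left in the rank bound after that round, see \<open>rank_swap\<close>.\<close>

definition swap_positions :: "nat \<Rightarrow> nat \<Rightarrow> nat set" where
  "swap_positions d N = {i \<in> {1..<N}. even (i + d)}"

text \<open>The rank bound starts at position 2, since position 1 has rank 0. The bijection serves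
  to find the required qubit and to tell all others from it.\<close>

definition valid_stack ::
    "nat \<Rightarrow> nat \<Rightarrow> 'q set \<Rightarrow> (nat \<Rightarrow> 'q) \<Rightarrow> nat \<Rightarrow> 'q stack \<Rightarrow> bool" where
  "valid_stack N T Q q s c \<longleftrightarrow>
     bij_betw (qubit_at c) {1..N} Q \<and>
     (\<forall>i\<in>{1..N}. is_label T q s (qubit_at c i) (label_at c i)) \<and>
     (\<forall>i\<in>{2..N}. i \<le> 2 * rank (snd \<circ> c) i)"

theorem mainTheorem3:
  fixes N T :: nat
    and Q :: "'q set"
    and q :: "nat \<Rightarrow> 'q"
    and c :: "nat \<Rightarrow> 'q stack"
  assumes "N \<ge> 1" and "T \<ge> 1"
    and placed: "bij_betw (qubit_at (c 1)) {1..N} Q"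
    and required: "\<forall>s\<in>{1..T}. q s \<in> Q"
    and init_labels: "\<forall>i\<in>{1..N}. is_label T q 1 (qubit_at (c 1) i) (label_at (c 1) i)"
    and init_top: "label_at (c 1) 1 = 1"
    and init_ordered: "\<forall>i. 1 \<le> i \<and> i < N \<longrightarrow> label_at (c 1) i < label_at (c 1) (i + 1)"
    and procedure: "\<forall>s\<in>{1..T}. next_stack N T q s (c s) (c (s + 1))"
  shows "\<forall>s\<in>{1..T}.
           (\<forall>i\<in>{1..N}. label_at (c s) 1 \<le> label_at (c s) i) \<and>
           label_at (c s) 1 = s \<and>
           qubit_at (c s) 1 = q s"
proof -

  \<comment> \<open>Counting labels above a position\<close>
  have count_above_Suc: "count_above m (Suc i) v = count_above m i v + (if m i \<le> v then 1 else 0)"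
    if hyps: "i \<ge> 1" for m i v
  proof -
    have "{l \<in> {1..<Suc i}. m l \<le> v} =
        (if m i \<le> v then insert i {l \<in> {1..<i}. m l \<le> v} else {l \<in> {1..<i}. m l \<le> v})"
      using hyps by (auto simp: less_Suc_eq)
    then show ?thesis by (simp add: count_above_def)
  qed
  have count_above_mono: "count_above m i v \<le> count_above m i w" if "v \<le> w" for m i v w
    using that unfolding count_above_def by (intro card_mono) auto
  have count_above_comp: "count_above (m \<circ> p) i v = count_above m i v"
    if hyps: "bij_betw p {1..<i} {1..<i}" for m p i v
  proof -
    have "p ` {l \<in> {1..<i}. (m \<circ> p) l \<le> v} = {l \<in> p ` {1..<i}. m l \<le> v}" by auto
    also have "p ` {1..<i} = {1..<i}" using hyps by (rule bij_betw_imp_surj_on)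
    finally have "bij_betw p {l \<in> {1..<i}. (m \<circ> p) l \<le> v} {l \<in> {1..<i}. m l \<le> v}"
      by (rule bij_betw_subset[OF hyps Collect_restrict])
    then show ?thesis
      unfolding count_above_def by (rule bij_betw_same_card)
  qed
  have count_above_fun_upd_top: "count_above m i v \<le> Suc (count_above (m(1 := k)) i v)" for m i v k
  proof -
    have "card {l \<in> {1..<i}. m l \<le> v} \<le> card (insert 1 {l \<in> {1..<i}. (m(1 := k)) l \<le> v})"
      by (rule card_mono) auto
    also have "\<dots> \<le> Suc (card {l \<in> {1..<i}. (m(1 := k)) l \<le> v})"
      by (rule card_insert_le_m1) auto
    finally show ?thesis by (simp add: count_above_def)
  qed
  \<comment> \<open>Positive rank yields a position further up with a label at most as large;
    repeating this ends at position 1.\<close>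
  have top_le_of_rank_pos: "m 1 \<le> m i"
    if hyps: "\<And>i. i \<in> {2..N} \<Longrightarrow> rank m i > 0" "i \<in> {1..N}" for m i
    using hyps(2)
  proof (induction i rule: less_induct)
    case (less i)
    show ?case
    proof (cases "i = 1")
      case False
      with less.prems have "rank m i > 0" by (intro hyps(1)) auto
      then have "{l \<in> {1..<i}. m l \<le> m i} \<noteq> {}"
        unfolding count_above_def by (auto simp: card_gt_0_iff)
      then obtain l where "l \<in> {1..<i}" "m l \<le> m i" by blast
      with less.IH[of l] less.prems show ?thesis by auto
    qed simp
  qed

  \<comment> \<open>Swap rounds as permutations, and their effect on ranks\<close>
  have swap_round_eq: "swap_round L c = c \<circ> swap_index L (snd \<circ> c)" for L and c :: "'q stack"
    by (auto simp: swap_round_def swap_index_def fun_eq_iff)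
  \<comment> \<open>With disjoint pairs the map is an involution, and no pair straddles either end
    of \<open>{1..n}\<close>. The bound \<open>n\<close> is free because the map is also restricted
    to the positions above a given one.\<close>
  have bij_betw_swap_index: "bij_betw (swap_index L m) {1..n} {1..n}"
    if hyps: "\<And>i. i \<in> L \<Longrightarrow> i + 1 \<notin> L" "0 \<notin> L" "n \<notin> L" for L m n
  proof -
    have step: "swap_index L m i \<in> {1..n}" "swap_index L m (swap_index L m i) = i"
      if i: "i \<in> {1..n}" for i
    proof -
      obtain j where j: "i = Suc j" using i by (cases i) simp_all
      have "j \<noteq> 0" if "j \<in> L" using that hyps(2) by (intro notI) simp
      moreover have "Suc j < n" if "Suc j \<in> L"
        using that hyps(3) i j by (cases "Suc j = n") simp_all
      ultimately show "swap_index L m i \<in> {1..n}"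
        using i by (simp add: j swap_index_def Suc_le_eq)
      show "swap_index L m (swap_index L m i) = i"
      proof (cases "i \<in> L \<and> m i > m (i + 1)")
        case True
        then have "swap_index L m i = Suc i" by (simp add: swap_index_def)
        moreover have "swap_index L m (Suc i) = i"
          using True hyps(1)[of i] by (simp add: swap_index_def)
        ultimately show ?thesis by simp
      next
        case no_down: False
        show ?thesis
        proof (cases "j \<in> L \<and> m j > m i")
          case True
          then have "i \<notin> L" using hyps(1)[of j] j by simp
          then have "swap_index L m i = j" using True by (simp add: j swap_index_def)
          moreover have "swap_index L m j = i" using True by (simp add: j swap_index_def)
          ultimately show ?thesis by simp
        next
          case False
          then have "swap_index L m i = i" using no_down by (simp add: j swap_index_def)
          then show ?thesis by simp
        qed
      qed
    qed
    have maps: "swap_index L m ` {1..n} \<subseteq> {1..n}" using step(1) by (rule image_subsetI)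
    show ?thesis
      by (rule bij_betw_byWitness[OF ballI[OF step(2)] ballI[OF step(2)] maps maps])
  qed
  have round1_eq: "round1 N = (swap_round (swap_positions 1 N) :: 'q stack \<Rightarrow> 'q stack)"
  proof -
    have "{2 * n + 1 | n. 2 * n + 2 \<le> N} = swap_positions 1 N"
      by (auto simp: swap_positions_def elim!: oddE)
    then show ?thesis by (simp add: round1_def)
  qed
  have round2_eq: "round2 N = (swap_round (swap_positions 0 N) :: 'q stack \<Rightarrow> 'q stack)"
  proof -
    have "{2 * n | n. n \<ge> 1 \<and> 2 * n + 1 \<le> N} = swap_positions 0 N"
      by (auto simp: swap_positions_def elim!: evenE)
    then show ?thesis by (simp add: round2_def)
  qed
  \<comment> \<open>One round lowers the slack from \<open>Suc d\<close> to \<open>d\<close>. The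
    parity of \<open>i + d\<close> decides whether \<open>i\<close> can be the lower or the upper
    member of a compared pair.\<close>
  have rank_swap: "bij_betw (swap_index (swap_positions d N) m) {1..N} {1..N} \<and>
    (\<forall>i\<in>{2..N}. i \<le> 2 * rank m' i + d)"
    if m'_def: "m' = m \<circ> swap_index (swap_positions d N) m"
      and bound: "\<And>i. i \<in> {1..N} \<Longrightarrow> i \<le> 2 * rank m i + Suc d" for m m' d
  proof (intro conjI ballI)
    let ?L = "swap_positions d N"
    have bij: "bij_betw (swap_index ?L m) {1..n} {1..n}" if "n \<notin> ?L" for n
      using that by (intro bij_betw_swap_index) (auto simp: swap_positions_def)
    then show "bij_betw (swap_index ?L m) {1..N} {1..N}" by (simp add: swap_positions_def)
    fix i assume i: "i \<in> {2..N}"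
    \<comment> \<open>If no pair joins \<open>j - 1\<close> and \<open>j\<close>, the round only
      permutes the positions above \<open>j\<close>.\<close>
    have count_eq: "count_above m' j v = count_above m j v" if "j - 1 \<notin> ?L" "j \<ge> 1" for j v
    proof -
      have "{1..<j} = {1..j - 1}" using that(2) by auto
      then show ?thesis
        unfolding m'_def using bij[OF that(1)] by (intro count_above_comp) simp
    qed
    obtain j where j: "i = Suc j" "1 \<le> j" "j < N"
      using i by (cases i) simp_all
    show "i \<le> 2 * rank m' i + d"
    proof (cases "even (j + d)")
      case True
      then have pair: "j \<in> ?L" "i \<notin> ?L" "j - 1 \<notin> ?L"
        using j by (cases j; simp add: swap_positions_def)+
      \<comment> \<open>Swapped or not, the pair leaves its larger label at the lower position
        \<open>i\<close>. So \<open>j\<close> itself is counted, which adds 1 to the rank.\<close>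
      have le: "m' j \<le> m' i" "m j \<le> m' i"
        using j pair by (simp_all add: m'_def swap_index_def)
      have "rank m' i = count_above m j (m' i) + 1"
        using le j pair count_eq[of j] by (simp add: count_above_Suc)
      moreover have "rank m j \<le> count_above m j (m' i)"
        using le(2) by (rule count_above_mono)
      ultimately show ?thesis
        using bound[of j] j by simp
    next
      case False
      then have j_notin: "j \<notin> ?L" by (simp add: swap_positions_def)
      then have eq: "count_above m' i v = count_above m i v" for v
        using count_eq[of i v] j by simp
      show ?thesis
      proof (cases "i \<in> ?L \<and> m i > m (i + 1)")
        case True
        then have "i < N" by (simp add: swap_positions_def)
        \<comment> \<open>The label moving up from \<open>Suc i\<close> did not count the larger
          \<open>m i\<close>, so its rank is kept while its position number drops by 1.\<close>
        have "m' i = m (Suc i)" using True by (simp add: m'_def swap_index_def)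
        moreover have "rank m (Suc i) = count_above m i (m (Suc i))"
          using True j by (simp add: count_above_Suc)
        ultimately show ?thesis
          using eq j bound[of "Suc i"] \<open>i < N\<close> by simp
      next
        case no_swap: False
        then have "m' i = m i"
          using j j_notin by (simp add: m'_def swap_index_def)
        \<comment> \<open>Here \<open>i + d\<close> is even, so equality in the bound fails by
          parity, and the strict inequality gives the gain of 1.\<close>
        moreover have "i \<noteq> 2 * rank m i + Suc d"
          using False j(1) by presburger
        ultimately show ?thesis
          using eq j bound[of i] by simp
      qed
    qed
  qed
  \<comment> \<open>The slack runs 0, 2, 1, 0 through relabelling and the two rounds. The
    permutation \<open>p\<close> is exported so that the other two conjuncts of
    \<open>valid_stack\<close> can be carried along.\<close>
  have rounds_restore_rank: "\<exists>p. bij_betw p {1..N} {1..N} \<and>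
      round2 N (round1 N (c(1 := (x, k)))) = c(1 := (x, k)) \<circ> p \<and>
      (\<forall>i\<in>{2..N}. i \<le> 2 * rank (snd \<circ> round2 N (round1 N (c(1 := (x, k))))) i)"
    if half: "\<forall>i\<in>{2..N}. i \<le> 2 * rank (snd \<circ> c) i" for c :: "'q stack" and x k
  proof -
    define c1 where "c1 = c(1 := (x, k))"
    define p1 where "p1 = swap_index (swap_positions 1 N) (snd \<circ> c1)"
    define c2 where "c2 = c1 \<circ> p1"
    define p2 where "p2 = swap_index (swap_positions 0 N) (snd \<circ> c2)"
    have snd_c1: "snd \<circ> c1 = (snd \<circ> c)(1 := k)" by (auto simp: c1_def)
    \<comment> \<open>\<open>Suc 1\<close> is twice the one unit of rank lost by relabelling;
      position 1 satisfies the bound trivially.\<close>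
    have "j \<le> 2 * rank (snd \<circ> c1) j + Suc 1" if "j \<in> {1..N}" for j
    proof (cases "j = 1")
      case False
      with that have "j \<in> {2..N}" by auto
      moreover from False have "(snd \<circ> c1) j = (snd \<circ> c) j" by (simp add: c1_def)
      ultimately show ?thesis
        using bspec[OF half, of j] count_above_fun_upd_top[of "snd \<circ> c" j "(snd \<circ> c) j" k]
        unfolding snd_c1 by simp
    qed simp
    note round1 = rank_swap[OF refl this, folded p1_def]
    then have "j \<le> 2 * rank (snd \<circ> c2) j + Suc 0" if "j \<in> {1..N}" for j
      using that by (cases "j = 1") (simp_all add: c2_def o_assoc)
    note round2 = rank_swap[OF refl this, folded p2_def]
    have eq: "round2 N (round1 N c1) = c2 \<circ> p2"
      by (simp add: round1_eq round2_eq swap_round_eq p1_def p2_def c2_def)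
    show ?thesis
    proof (unfold c1_def[symmetric], intro exI[of _ "p1 \<circ> p2"] conjI)
      show "bij_betw (p1 \<circ> p2) {1..N} {1..N}"
        using round1 round2 by (blast intro: bij_betw_trans)
      show "round2 N (round1 N c1) = c1 \<circ> (p1 \<circ> p2)"
        using eq by (simp add: c2_def o_assoc)
      show "\<forall>i\<in>{2..N}. i \<le> 2 * rank (snd \<circ> round2 N (round1 N c1)) i"
        using round2 unfolding eq by (simp add: o_assoc)
    qed
  qed

  \<comment> \<open>Labels over time, and the invariant along the procedure\<close>
  have is_label_ge: "s \<le> k" if hyps: "is_label T q s x k" "s \<le> T" for s x k
  proof (cases "\<exists>t\<in>{s..T}. q t = x")
    case True
    then have "\<exists>t. t \<in> {s..T} \<and> q t = x" by blast
    from LeastI_ex[OF this] hyps(1) True show ?thesis by (simp add: is_label_def)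
  qed (use hyps in \<open>auto simp: is_label_def\<close>)
  have is_label_current_iff: "k = s \<longleftrightarrow> q s = x" if hyps: "is_label T q s x k" "s \<le> T" for s x k
  proof
    assume "q s = x"
    then have "(LEAST t. t \<in> {s..T} \<and> q t = x) = s"
      using hyps(2) by (intro Least_equality) auto
    with hyps \<open>q s = x\<close> show "k = s" by (auto simp: is_label_def split: if_splits)
  next
    assume "k = s"
    with hyps(2) have "\<not> k > T" by simp
    with hyps(1) have ex: "\<exists>t. t \<in> {s..T} \<and> q t = x"
      and k: "k = (LEAST t. t \<in> {s..T} \<and> q t = x)"
      unfolding is_label_def Bex_def by presburger+
    from LeastI_ex[OF ex] show "q s = x"
      unfolding k[symmetric] \<open>k = s\<close> by blast
  qed
  \<comment> \<open>The uses from \<open>s\<close> on and from \<open>s + 1\<close> on coincide for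
    a qubit other than \<open>q s\<close>, so its old label remains correct.\<close>
  have is_label_Suc: "is_label T q (s + 1) x k" if hyps: "is_label T q s x k" "q s \<noteq> x" for s x k
  proof -
    have "t \<in> {s..T} \<and> q t = x \<longleftrightarrow> t \<in> {s + 1..T} \<and> q t = x" for t
      using hyps(2) by (cases "t = s") auto
    then show ?thesis
      using hyps(1) unfolding is_label_def Bex_def by simp
  qed
  \<comment> \<open>The required qubit lies somewhere in the stack and has label \<open>s\<close>.
    No label is below \<open>s\<close> and the top one is minimal, so the top label is
    \<open>s\<close>, which identifies the qubit there.\<close>
  have valid_stack_top: "(\<forall>i\<in>{1..N}. label_at c 1 \<le> label_at c i) \<and> label_at c 1 = s \<and> qubit_at c 1 = q s"
    if hyps: "valid_stack N T Q q s c" "s \<le> T" "q s \<in> Q" for s c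
  proof -
    have bij: "bij_betw (qubit_at c) {1..N} Q"
      and lab: "\<forall>i\<in>{1..N}. is_label T q s (qubit_at c i) (label_at c i)"
      and half: "\<forall>i\<in>{2..N}. i \<le> 2 * rank (snd \<circ> c) i"
      using hyps(1) unfolding valid_stack_def by blast+
    have "rank (snd \<circ> c) i > 0" if "i \<in> {2..N}" for i
      using bspec[OF half that] that by simp
    then have min: "\<forall>i\<in>{1..N}. label_at c 1 \<le> label_at c i"
      using top_le_of_rank_pos[of "snd \<circ> c"] by simp
    from bij_betw_imp_surj_on[OF bij] hyps(3)
    obtain i where i: "i \<in> {1..N}" "qubit_at c i = q s" by auto
    then have "label_at c i = s"
      using is_label_current_iff[OF bspec[OF lab i(1)] hyps(2)] by simp
    moreover have "1 \<in> {1..N}" using i(1) by simp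
    note lab_top = bspec[OF lab this]
    ultimately have top: "label_at c 1 = s"
      using bspec[OF min i(1)] is_label_ge[OF lab_top hyps(2)] by simp
    then have "qubit_at c 1 = q s"
      using is_label_current_iff[OF lab_top hyps(2)] by simp
    with min top show ?thesis by blast
  qed
  have valid_stack_next: "valid_stack N T Q q (s + 1) c'"
    if valid: "valid_stack N T Q q s c" and top: "qubit_at c 1 = q s"
      and nxt: "next_stack N T q s c c'" for s c c'
  proof -
    from nxt obtain k where k: "is_label T q (s + 1) (qubit_at c 1) k"
      and c': "c' = round2 N (round1 N (c(1 := (qubit_at c 1, k))))"
      unfolding next_stack_def by blast
    have bij: "bij_betw (qubit_at c) {1..N} Q"
      and lab: "\<forall>i\<in>{1..N}. is_label T q s (qubit_at c i) (label_at c i)"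
      and half: "\<forall>i\<in>{2..N}. i \<le> 2 * rank (snd \<circ> c) i"
      using valid unfolding valid_stack_def by blast+
    define c1 where "c1 = c(1 := (qubit_at c 1, k))"
    obtain p where p: "bij_betw p {1..N} {1..N}" and c'_eq: "c' = c1 \<circ> p"
      and half': "\<forall>i\<in>{2..N}. i \<le> 2 * rank (snd \<circ> c') i"
      using rounds_restore_rank[OF half] unfolding c' c1_def by metis
    have "(\<lambda>i. qubit_at c1 i) = qubit_at c" by (auto simp: c1_def)
    then have "(\<lambda>i. qubit_at c' i) = qubit_at c \<circ> p" by (simp add: c'_eq fun_eq_iff)
    then have "bij_betw (qubit_at c') {1..N} Q"
      using bij_betw_trans[OF p bij] by simp
    moreover have lab1: "is_label T q (s + 1) (qubit_at c1 i) (label_at c1 i)" if "i \<in> {1..N}" for i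
    proof (cases "i = 1")
      case False
      \<comment> \<open>Injectivity of the placement keeps \<open>q s\<close> out of all positions
        but the top, so only the top needs a new label.\<close>
      have "qubit_at c i \<noteq> qubit_at c 1"
        using inj_onD[OF bij_betw_imp_inj_on[OF bij], of i 1] that False by force
      then have "q s \<noteq> qubit_at c i" using top by simp
      with bspec[OF lab that] have "is_label T q (s + 1) (qubit_at c i) (label_at c i)"
        by (rule is_label_Suc)
      then show ?thesis using False by (simp add: c1_def)
    qed (use k in \<open>simp add: c1_def\<close>)
    have "is_label T q (s + 1) (qubit_at c' i) (label_at c' i)" if "i \<in> {1..N}" for i
      using lab1[OF bij_betwE[OF p, rule_format, OF that]] by (simp add: c'_eq)
    ultimately show ?thesis using half' unfolding valid_stack_def by blast
  qed
  have rank_of_ordered: "rank m i = i - 1"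
    if hyps: "\<forall>i. 1 \<le> i \<and> i < N \<longrightarrow> m i < m (i + 1)" "i \<in> {1..N}" for m i
  proof -
    have "m l \<le> m i" if "1 \<le> l" "l \<le> i" for l
      using that(2,1) hyps(2)
    proof (induction rule: inc_induct)
      case (step n)
      then have "m n < m (Suc n)" "m (Suc n) \<le> m i" using hyps(1) by auto
      then show ?case by simp
    qed simp
    then have "{l \<in> {1..<i}. m l \<le> m i} = {1..<i}" by auto
    then show ?thesis by (simp add: count_above_def)
  qed
  show ?thesis
  proof
    fix s assume s: "s \<in> {1..T}"
    \<comment> \<open>For \<open>i \<ge> 2\<close> one has \<open>i \<le> 2 * (i - 1)\<close>, so
      the ordered stack satisfies the invariant.\<close>
    have "rank (snd \<circ> c 1) i = i - 1" if "i \<in> {2..N}" for i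
      using that init_ordered by (intro rank_of_ordered) auto
    then have init: "valid_stack N T Q q 1 (c 1)"
      using placed init_labels by (auto simp: valid_stack_def)
    have top: "(\<forall>i\<in>{1..N}. label_at (c t) 1 \<le> label_at (c t) i) \<and>
        label_at (c t) 1 = t \<and> qubit_at (c t) 1 = q t"
      if "valid_stack N T Q q t (c t)" "t \<in> {1..T}" for t
      using that required by (intro valid_stack_top) auto
    have "1 \<le> s" "s \<le> T" using s by auto
    then have "valid_stack N T Q q s (c s)"
    proof (induction s rule: dec_induct)
      case (step n)
      \<comment> \<open>The conclusion at step \<open>n\<close> is part of the induction: it ensures
        that the relabelled qubit is \<open>q n\<close>.\<close>
      then show ?case
        using valid_stack_next[of n "c n" "c (Suc n)"] top[of n] procedure by simp
    qed (rule init)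
    then show "(\<forall>i\<in>{1..N}. label_at (c s) 1 \<le> label_at (c s) i) \<and>
        label_at (c s) 1 = s \<and> qubit_at (c s) 1 = q s"
      using s by (rule top)
  qed
qed

end
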